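(* Let $\mathcal{B}\subseteq\mathbb{N}$ be a non-empty set that is primitive and proximal. Then $X_\varphi=\tilde{X}_\varphi$, i.e. $X_\varphi$ is hereditary.
   Context: $\mathbb{N}=\{1,2,\dots\}$. A set $\mathcal{B}\subseteq\mathbb{N}$ is primitive if there are no distinct $b,b'\in\mathcal{B}$ with $b\mid b'$. Let $\Delta:\mathbb{Z}\to\prod_{b\in\mathcal{B}}\mathbb{Z}/b\mathbb{Z}$, $\Delta(n)=(n,n,\dots)$, be the canonical diagonal embedding (the product carries the product topology of discrete finite groups), and let $H:=\overline{\Delta(\mathbb{Z})}$, a compact abelian group. The window is $W:=\{h\in H: h_b\neq 0\ \text{for all } b\in\mathcal{B}\}$. The coding function $\varphi:H\to\{0,1\}^{\mathbb{Z}}$ is defined by $\varphi(h)(n)=1$ if and only if $h+\Delta(n)\in W$. Let $\eta:=\varphi(\Delta(0))$ (the characteristic function of $\mathbb{Z}\setminus\bigcup_{b\in\mathcal{B}}b\mathbb{Z}$), let $X_\eta$ be the orbit closure of $\eta$ in $\{0,1\}^{\mathbb{Z}}$ under the left shift, and let $X_\varphi:=\overline{\varphi(H)}$. The set $\mathcal{B}$ is called proximal if $(\dots,0,0,0,\dots)\in X_\eta$; for primitive $\mathcal{B}$ it is known that this is equivalent to $\operatorname{int}(W)=\emptyset$ (interior in $H$), and also to $\mathcal{B}$ containing an infinite pairwise co-prime subset or being $\{1\}$. For a closed subshift $X\subseteq\{0,1\}^{\mathbb{Z}}$, its hereditary closure is $\tilde X:=\{x'\in\{0,1\}^{\mathbb{Z}}:\exists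 x\in X\text{ such that }x'\leqslant x\}$ (coordinatewise order), and $X$ is hereditary if $\tilde X=X$. *)

theory Defs
  imports "HOL-Analysis.Analysis" "HOL-Algebra.Product_Groups"
begin

definition primitive :: "nat set \<Rightarrow> bool" where
  "primitive B \<longleftrightarrow> (\<forall>b\<in>B. \<forall>b'\<in>B. b \<noteq> b' \<longrightarrow> \<not> b dvd b')"

(* For b > 0 the library represents Z/bZ by the residues {0..<b} with addition mod b.
   Elements of the product are functions extensional on B. *)

definition prod_grp :: "nat set \<Rightarrow> (nat \<Rightarrow> int) monoid" where
  "prod_grp B = product_group B integer_mod_group"

definition prod_top :: "nat set \<Rightarrow> (nat \<Rightarrow> int) topology" where
  "prod_top B = product_topology (\<lambda>b. discrete_topology (carrier (integer_mod_group b))) B"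

definition diag :: "nat set \<Rightarrow> int \<Rightarrow> nat \<Rightarrow> int" where
  "diag B n = (\<lambda>b\<in>B. n mod int b)"

definition H :: "nat set \<Rightarrow> (nat \<Rightarrow> int) set" where
  "H B = prod_top B closure_of range (diag B)"

definition window :: "nat set \<Rightarrow> (nat \<Rightarrow> int) set" where
  "window B = {h \<in> H B. \<forall>b\<in>B. h b \<noteq> \<one>\<^bsub>integer_mod_group b\<^esub>}"

definition full_shift :: "(int \<Rightarrow> nat) topology" where
  "full_shift = product_topology (\<lambda>_. discrete_topology {0, 1}) UNIV"

definition coding :: "nat set \<Rightarrow> (nat \<Rightarrow> int) \<Rightarrow> int \<Rightarrow> nat" where
  "coding B h n = (if h \<otimes>\<^bsub>prod_grp B\<^esub> diag B n \<in> window B then 1 else 0)"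

definition eta :: "nat set \<Rightarrow> int \<Rightarrow> nat" where
  "eta B = coding B (diag B 0)"

(* The k-th iterate of the left shift; negative k iterates its inverse. *)
definition shift :: "int \<Rightarrow> (int \<Rightarrow> nat) \<Rightarrow> int \<Rightarrow> nat" where
  "shift k x = (\<lambda>n. x (n + k))"

definition orbit_closure :: "(int \<Rightarrow> nat) \<Rightarrow> (int \<Rightarrow> nat) set" where
  "orbit_closure x = full_shift closure_of range (\<lambda>k. shift k x)"

definition X_eta :: "nat set \<Rightarrow> (int \<Rightarrow> nat) set" where
  "X_eta B = orbit_closure (eta B)"

definition X_phi :: "nat set \<Rightarrow> (int \<Rightarrow> nat) set" where
  "X_phi B = full_shift closure_of (coding B ` H B)"

definition proximal :: "nat set \<Rightarrow> bool" where
  "proximal B \<longleftrightarrow> (\<lambda>_. 0) \<in> X_eta B"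

(* The order on functions is coordinatewise. *)
definition hereditary_closure :: "(int \<Rightarrow> nat) set \<Rightarrow> (int \<Rightarrow> nat) set" where
  "hereditary_closure X = {x' \<in> topspace full_shift. \<exists>x\<in>X. x' \<le> x}"

definition hereditary :: "(int \<Rightarrow> nat) set \<Rightarrow> bool" where
  "hereditary X \<longleftrightarrow> hereditary_closure X = X"

lemma topspace_full_shift: "topspace full_shift = {x. \<forall>n. x n = 0 \<or> x n = 1}"
  by (auto simp: full_shift_def PiE_def Pi_def)

lemma diag_in_H:
  assumes "0 \<notin> B"
  shows "diag B n \<in> H B"
proof -
  have "diag B k \<in> topspace (prod_top B)" for k
  proof -
    have "k mod int b \<in> carrier (integer_mod_group b)" if "b \<in> B" for b
    proof -
      have "b > 0"
        using assms that by (cases b) auto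
      then show ?thesis
        by (simp add: integer_mod_group_def)
    qed
    then show ?thesis
      unfolding prod_top_def diag_def by simp
  qed
  then show ?thesis
    unfolding H_def using closure_of_subset[of "range (diag B)" "prod_top B"] by blast
qed

lemma diag_add: "diag B m \<otimes>\<^bsub>prod_grp B\<^esub> diag B n = diag B (m + n)"
proof
  fix b
  show "(diag B m \<otimes>\<^bsub>prod_grp B\<^esub> diag B n) b = diag B (m + n) b"
    by (cases "b \<in> B")
       (simp_all add: prod_grp_def product_group_def diag_def integer_mod_group_def mod_add_eq)
qed

lemma eta_eq:
  assumes "0 \<notin> B"
  shows "eta B n = (if n \<in> (\<Union>b\<in>B. {k. int b dvd k}) then 0 else 1)"
proof -
  have "diag B n \<in> window B \<longleftrightarrow> (\<forall>b\<in>B. \<not> int b dvd n)"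
    using diag_in_H[OF assms, of n]
    by (auto simp: window_def integer_mod_group_def diag_def dvd_eq_mod_eq_0)
  then show ?thesis
    by (simp add: eta_def coding_def diag_add)
qed

end

theory Submission
  imports Defs "HOL-Number_Theory.Cong"
begin

text \<open>
  To see that \<^term>\<open>X_phi B\<close> is hereditary it suffices, by the definition of the product
  topology, to change finitely many ones of a point \<^term>\<open>coding B h\<close> into zeros while keeping
  its other values on a given finite set \<open>I\<close> of positions; and this can be done one position
  \<open>k\<close> at a time.

  A zero at \<open>k\<close> is produced by an element \<open>c\<close> of \<open>B\<close> and a point \<open>h'\<close> of \<open>H\<close> with
  \<open>h'\<^sub>c \<equiv> -k\<close> modulo \<open>c\<close>. Coordinates of points of \<open>H\<close> are not independent, so \<open>h'\<close> has to be
  chosen with care. Let \<open>e\<close> be the limit of \<open>c ^ t!\<close> in the profinite integers. It is an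
  idempotent: it vanishes in the \<open>p\<close>-adic integers for the primes \<open>p\<close> dividing \<open>c\<close>, and is 1 in
  the others. Put \<open>h' = e (h + k) - k\<close>, that is, leave \<open>h\<close> alone away from \<open>c\<close> and replace it
  by \<open>-k\<close> at the primes dividing \<open>c\<close>. If \<open>b\<close> is coprime to \<open>c\<close>, then \<open>h'\<^sub>b = h\<^sub>b\<close>. If not, then
  \<open>h'\<^sub>b + j\<close> is congruent to \<open>j - k\<close> modulo \<open>gcd b c\<close>, so it cannot be divisible by \<open>b\<close> once \<open>c\<close> is
  coprime to \<open>j - k\<close>. Hence the ones at positions \<open>j \<noteq> k\<close> in \<open>I\<close> survive if \<open>c\<close> is coprime to
  all these differences, and the zeros survive if \<open>c\<close> is also coprime to one witness \<open>b\<close> for each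
  zero of \<open>coding B h\<close> in \<open>I\<close>.

  So all that is needed is an element of \<open>B\<close> coprime to a prescribed \<open>M\<close>. Proximality provides it:
  \<open>M\<close> consecutive integers that are all multiples of elements of \<open>B\<close> include one that is 1
  modulo \<open>M\<close>.
\<close>

section \<open>Closures in products of discrete spaces\<close>

lemma in_closure_of_product_discrete:
  assumes S: "S \<subseteq> PiE I D"
  shows "x \<in> product_topology (\<lambda>i. discrete_topology (D i)) I closure_of S \<longleftrightarrow>
           x \<in> PiE I D \<and> (\<forall>F. finite F \<and> F \<subseteq> I \<longrightarrow> (\<exists>y\<in>S. \<forall>i\<in>F. y i = x i))"
    (is "x \<in> ?T closure_of S \<longleftrightarrow> ?R")
proof
  assume x: "x \<in> ?T closure_of S"
  then have xD: "x \<in> PiE I D"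
    using in_closure_of[of x ?T S] by simp
  have "\<exists>y\<in>S. \<forall>i\<in>F. y i = x i" if "finite F" "F \<subseteq> I" for F
  proof -
    define U where "U = PiE I (\<lambda>i. if i \<in> F then {x i} else D i)"
    have "{i \<in> I. (if i \<in> F then {x i} else D i) \<noteq> topspace (discrete_topology (D i))} \<subseteq> F"
      by auto
    then have "openin ?T U"
      unfolding U_def openin_PiE_gen
      using that xD by (auto intro: finite_subset simp: PiE_iff)
    moreover have "x \<in> U"
      using xD by (auto simp: U_def PiE_iff)
    ultimately obtain y where "y \<in> S" "y \<in> U"
      using x unfolding in_closure_of by blast
    then show ?thesis
      using that by (auto simp: U_def PiE_iff intro!: bexI[of _ y] split: if_splits)
  qed
  then show ?R
    using xD by blast
next
  assume R: ?R
  show "x \<in> ?T closure_of S"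
    unfolding in_closure_of
  proof (intro conjI allI impI)
    show "x \<in> topspace ?T"
      using R by simp
    fix U assume "x \<in> U \<and> openin ?T U"
    then have "\<exists>V. finite {i \<in> I. V i \<noteq> topspace (discrete_topology (D i))} \<and>
        (\<forall>i\<in>I. openin (discrete_topology (D i)) (V i)) \<and> x \<in> PiE I V \<and> PiE I V \<subseteq> U"
      unfolding openin_product_topology_alt by blast
    then obtain V where fin: "finite {i \<in> I. V i \<noteq> D i}"
      and xV: "x \<in> PiE I V" and VU: "PiE I V \<subseteq> U"
      by auto
    have "\<exists>y\<in>S. \<forall>i\<in>{i \<in> I. V i \<noteq> D i}. y i = x i"
      using R fin by blast
    then obtain y where y: "y \<in> S" "\<And>i. i \<in> I \<Longrightarrow> V i \<noteq> D i \<Longrightarrow> y i = x i"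
      by blast
    have "y \<in> PiE I D"
      using S y(1) by blast
    then have "y \<in> PiE I V"
      using xV y(2) unfolding PiE_iff by metis
    then show "\<exists>y. y \<in> S \<and> y \<in> U"
      using y(1) VU by blast
  qed
qed

section \<open>The group H and the coding function\<close>

lemma carrier_integer_mod_group_pos:
  "b > 0 \<Longrightarrow> carrier (integer_mod_group b) = {0..<int b}"
  by (simp add: integer_mod_group_def)

lemma H_iff:
  assumes "0 \<notin> B"
  shows "h \<in> H B \<longleftrightarrow> h \<in> (\<Pi>\<^sub>E b\<in>B. {0..<int b}) \<and>
           (\<forall>F. finite F \<and> F \<subseteq> B \<longrightarrow> (\<exists>m. \<forall>b\<in>F. h b = m mod int b))"
proof -
  have pos: "b > 0" if "b \<in> B" for b
    using assms that by (cases b) auto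
  have C: "(\<Pi>\<^sub>E b\<in>B. carrier (integer_mod_group b)) = (\<Pi>\<^sub>E b\<in>B. {0..<int b})"
    by (intro PiE_cong) (simp add: carrier_integer_mod_group_pos pos)
  have "range (diag B) \<subseteq> (\<Pi>\<^sub>E b\<in>B. carrier (integer_mod_group b))"
    unfolding C by (auto simp: diag_def pos)
  then have "h \<in> H B \<longleftrightarrow> h \<in> (\<Pi>\<^sub>E b\<in>B. {0..<int b}) \<and>
      (\<forall>F. finite F \<and> F \<subseteq> B \<longrightarrow> (\<exists>y\<in>range (diag B). \<forall>b\<in>F. y b = h b))"
    unfolding H_def prod_top_def by (simp add: in_closure_of_product_discrete C)
  moreover have "(\<exists>y\<in>range (diag B). \<forall>b\<in>F. y b = h b) \<longleftrightarrow> (\<exists>m. \<forall>b\<in>F. h b = m mod int b)"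
    if "F \<subseteq> B" for F
  proof -
    have "(\<forall>b\<in>F. diag B m b = h b) \<longleftrightarrow> (\<forall>b\<in>F. h b = m mod int b)" for m
      using that by (intro ball_cong) (auto simp: diag_def)
    then show ?thesis
      by simp
  qed
  ultimately show ?thesis
    by (metis (no_types, lifting))
qed

lemma add_diag_apply:
  "b \<in> B \<Longrightarrow> (h \<otimes>\<^bsub>prod_grp B\<^esub> diag B n) b = (h b + n) mod int b"
  by (simp add: prod_grp_def product_group_def diag_def integer_mod_group_def mod_simps)

lemma add_diag_in_H:
  assumes "0 \<notin> B" and h: "h \<in> H B"
  shows "h \<otimes>\<^bsub>prod_grp B\<^esub> diag B n \<in> H B"
  unfolding H_iff[OF assms(1)]
proof (intro conjI allI impI)
  have pos: "b > 0" if "b \<in> B" for b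
    using assms that by (cases b) auto
  have "h \<otimes>\<^bsub>prod_grp B\<^esub> diag B n \<in> extensional B"
    by (simp add: prod_grp_def product_group_def)
  then show "h \<otimes>\<^bsub>prod_grp B\<^esub> diag B n \<in> (\<Pi>\<^sub>E b\<in>B. {0..<int b})"
    by (simp add: PiE_iff add_diag_apply pos)
  fix F assume F: "finite F \<and> F \<subseteq> B"
  then obtain m where "\<forall>b\<in>F. h b = m mod int b"
    using h unfolding H_iff[OF assms(1)] by blast
  then have "\<forall>b\<in>F. (h \<otimes>\<^bsub>prod_grp B\<^esub> diag B n) b = (m + n) mod int b"
    using F by (auto simp: add_diag_apply mod_simps subset_iff)
  then show "\<exists>m. \<forall>b\<in>F. (h \<otimes>\<^bsub>prod_grp B\<^esub> diag B n) b = m mod int b"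
    by blast
qed

lemma coding_eq:
  assumes "0 \<notin> B" and "h \<in> H B"
  shows "coding B h n = (if \<exists>b\<in>B. int b dvd h b + n then 0 else 1)"
  using add_diag_in_H[OF assms, of n]
  by (auto simp: coding_def window_def add_diag_apply dvd_eq_mod_eq_0)

lemma full_shift_closure_iff:
  assumes "\<And>y n. y \<in> S \<Longrightarrow> y n = 0 \<or> y n = 1"
  shows "x \<in> full_shift closure_of S \<longleftrightarrow>
           x \<in> topspace full_shift \<and> (\<forall>F. finite F \<longrightarrow> (\<exists>y\<in>S. \<forall>n\<in>F. y n = x n))"
proof -
  have "S \<subseteq> (\<Pi>\<^sub>E n\<in>UNIV. {0, 1})"
    using assms unfolding PiE_iff by blast
  then show ?thesis
    unfolding full_shift_def by (simp add: in_closure_of_product_discrete)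
qed

lemma X_phi_iff:
  "x \<in> X_phi B \<longleftrightarrow>
     x \<in> topspace full_shift \<and> (\<forall>F. finite F \<longrightarrow> (\<exists>h\<in>H B. \<forall>n\<in>F. coding B h n = x n))"
  unfolding X_phi_def by (subst full_shift_closure_iff) (auto simp: coding_def)

section \<open>Elements of proximal sets coprime to a given number\<close>

text \<open>A block of \<^term>\<open>M\<close> consecutive zeros of \<^term>\<open>eta B\<close> covers all residue classes
  modulo \<^term>\<open>M\<close>, in particular that of 1. A divisor in \<^term>\<open>B\<close> of a number in this class
  is coprime to \<^term>\<open>M\<close>.\<close>

lemma proximal_imp_coprime_element:
  fixes M :: int
  assumes "0 \<notin> B" and "proximal B" and "M > 0"
  obtains c where "c \<in> B" "coprime (int c) M"
proof -
  have "(\<lambda>_. 0) \<in> full_shift closure_of range (\<lambda>k. shift k (eta B))"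
    using assms(2) by (simp add: proximal_def X_eta_def orbit_closure_def)
  moreover have "y n = 0 \<or> y n = 1" if "y \<in> range (\<lambda>k. shift k (eta B))" for y n
    using that by (auto simp: shift_def eta_def coding_def)
  ultimately obtain k where k: "\<forall>n\<in>{0..<M}. eta B (n + k) = 0"
    by (subst (asm) full_shift_closure_iff) (auto simp: shift_def dest!: spec[of _ "{0..<M}"])
  define n where "n = (1 - k) mod M"
  have "eta B (n + k) = 0"
    using k assms(3) by (simp add: n_def)
  then obtain c where c: "c \<in> B" "int c dvd n + k"
    by (auto simp: eta_eq[OF assms(1)] split: if_splits)
  have "[n + k = 1] (mod M)"
    by (simp add: n_def cong_def mod_simps)
  then have "coprime (n + k) M"
    using cong_imp_coprime[OF cong_sym] by force
  then have "coprime (int c) M"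
    using c(2) coprime_divisors[OF _ dvd_refl] by blast
  with c(1) show ?thesis
    by (rule that)
qed

section \<open>The idempotent attached to an integer\<close>

text \<open>Two of the powers with exponents \<open>0, \<dots>, b\<close> agree modulo \<open>b\<close>, so the powers of \<open>c\<close> are
  periodic from some exponent at most \<open>b\<close> on, with a period \<open>q \<le> b\<close>. Now \<open>b!\<close> is large enough to
  lie in the periodic range and is a multiple of \<open>q\<close>.\<close>

lemma power_fact_idempotent_mod:
  fixes c :: int
  assumes "b > 0"
  shows "[c ^ fact b * c ^ fact b = c ^ fact b] (mod int b)"
proof -
  have "(\<lambda>i. c ^ i mod int b) ` {0..b} \<subseteq> {0..<int b}"
    using assms by auto
  then have "card ((\<lambda>i. c ^ i mod int b) ` {0..b}) \<le> b"
    using card_mono[of "{0..<int b}"] by fastforce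
  then have "\<not> inj_on (\<lambda>i. c ^ i mod int b) {0..b}"
    by (intro pigeonhole) simp
  then obtain i j where ij: "i < j" "j \<le> b" "[c ^ j = c ^ i] (mod int b)"
    unfolding inj_on_def cong_def by (metis atLeastAtMost_iff linorder_neqE_nat)
  define q where "q = j - i"
  have period: "[c ^ (n + q) = c ^ n] (mod int b)" if "n \<ge> i" for n
  proof -
    have "[c ^ (n - i) * c ^ j = c ^ (n - i) * c ^ i] (mod int b)"
      by (intro cong_mult ij(3) cong_refl)
    then show ?thesis
      using that ij(1) by (simp add: q_def flip: power_add)
  qed
  have periods: "[c ^ (n + q * s) = c ^ n] (mod int b)" if "n \<ge> i" for n s
  proof (induction s)
    case (Suc s)
    have "[c ^ (n + q * s + q) = c ^ (n + q * s)] (mod int b)"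
      using that by (intro period) simp
    with Suc show ?case
      by (simp add: add_ac cong_trans)
  qed simp
  have "q dvd fact b"
    using ij by (intro dvd_fact) (auto simp: q_def)
  then obtain s where s: "(fact b :: nat) = q * s" ..
  have "i \<le> fact b"
    using ij fact_ge_self[of b] by linarith
  from periods[OF this, of s] show ?thesis
    by (simp add: power_add flip: s)
qed

lemma power_fact_cong:
  fixes c :: int
  assumes "0 < b" "b \<le> t"
  shows "[c ^ fact t = c ^ fact b] (mod int b)"
proof -
  define e where "e = c ^ fact b"
  have e: "[e ^ Suc s = e] (mod int b)" for s
  proof (induction s)
    case (Suc s)
    have "[e * e ^ Suc s = e * e] (mod int b)"
      by (intro cong_mult Suc cong_refl)
    also have "[e * e = e] (mod int b)"
      using power_fact_idempotent_mod[OF assms(1)] by (simp add: e_def)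
    finally show ?case
      by simp
  qed simp
  obtain s where s: "(fact t :: nat) = fact b * s"
    using fact_dvd[OF assms(2)] by blast
  then obtain s' where "s = Suc s'"
    by (cases s) auto
  then show ?thesis
    using e[of s'] by (simp only: e_def s power_mult)
qed

lemma power_fact_cong_1:
  fixes c :: int
  assumes "b > 0" and "coprime c (int b)"
  shows "[c ^ fact b = 1] (mod int b)"
proof -
  have "coprime (c ^ fact b) (int b)"
    using assms(2) by simp
  moreover have "[c ^ fact b * c ^ fact b = c ^ fact b * 1] (mod int b)"
    using power_fact_idempotent_mod[OF assms(1)] by simp
  ultimately show ?thesis
    using cong_mult_lcancel by blast
qed

text \<open>The point \<open>e (h + k) - k\<close>, where \<open>e\<close> is the limit of \<open>c ^ t!\<close>; modulo \<open>b\<close> this sequence is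
  constant from \<open>t = b\<close> on, which makes the limit explicit.\<close>

definition pin :: "nat set \<Rightarrow> int \<Rightarrow> int \<Rightarrow> (nat \<Rightarrow> int) \<Rightarrow> nat \<Rightarrow> int" where
  "pin B c k h = (\<lambda>b\<in>B. (c ^ fact b * (h b + k) - k) mod int b)"

text \<open>If \<open>h\<close> is represented on a finite set of coordinates by the integer \<open>m\<close>, then the new point
  is represented there by \<open>c ^ t! (m + k) - k\<close> for any sufficiently large \<open>t\<close>.\<close>

lemma pin_in_H:
  assumes "0 \<notin> B" and h: "h \<in> H B"
  shows "pin B c k h \<in> H B"
  unfolding H_iff[OF assms(1)]
proof (intro conjI allI impI)
  have pos: "b > 0" if "b \<in> B" for b
    using assms that by (cases b) auto
  show "pin B c k h \<in> (\<Pi>\<^sub>E b\<in>B. {0..<int b})"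
    by (auto simp: pin_def pos)
  fix F assume F: "finite F \<and> F \<subseteq> B"
  then obtain m where m: "\<forall>b\<in>F. h b = m mod int b"
    using h unfolding H_iff[OF assms(1)] by blast
  obtain t where t: "\<forall>b\<in>F. b \<le> t"
    using F finite_nat_set_iff_bounded_le by blast
  have "pin B c k h b = (c ^ fact t * (m + k) - k) mod int b" if "b \<in> F" for b
  proof -
    have b: "b \<in> B" "b > 0"
      using that F pos by auto
    have "[h b = m] (mod int b)"
      using m that by (simp add: cong_def)
    moreover have "[c ^ fact b = c ^ fact t] (mod int b)"
      using power_fact_cong[of b t c] b(2) t that by (simp add: cong_sym)
    ultimately have "[c ^ fact b * (h b + k) - k = c ^ fact t * (m + k) - k] (mod int b)"
      by (intro cong_diff cong_mult cong_add cong_refl)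
    then show ?thesis
      using b(1) by (simp add: pin_def cong_def)
  qed
  then show "\<exists>m. \<forall>b\<in>F. pin B c k h b = m mod int b"
    by blast
qed

lemma pin_coprime:
  assumes "0 \<notin> B" and "h \<in> H B" and "b \<in> B" and "coprime c (int b)"
  shows "pin B c k h b = h b"
proof -
  have pos: "b > 0"
    using assms by (cases b) auto
  have hb: "h b mod int b = h b"
    using assms(2,3) unfolding H_iff[OF assms(1)] by (auto simp: PiE_iff)
  have "[c ^ fact b * (h b + k) - k = 1 * (h b + k) - k] (mod int b)"
    by (intro cong_diff cong_mult cong_refl power_fact_cong_1[OF pos assms(4)])
  then show ?thesis
    using assms(3) hb by (simp add: pin_def cong_def)
qed

text \<open>This is what places a zero at \<open>k\<close> (take \<open>b = c\<close>) and also what controls the coordinates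
  that the change unavoidably disturbs, those not coprime to \<open>c\<close>.\<close>

lemma gcd_dvd_pin:
  assumes "b \<in> B"
  shows "gcd c (int b) dvd pin B c k h b + k"
proof -
  have "c dvd c ^ fact b"
    by (rule dvd_power) simp
  then have "gcd c (int b) dvd c ^ fact b * (h b + k)"
    by (meson dvd_mult2 dvd_trans gcd_dvd1)
  moreover have "[pin B c k h b + k = c ^ fact b * (h b + k)] (mod int b)"
    using assms by (simp add: pin_def cong_def mod_simps)
  then have "[pin B c k h b + k = c ^ fact b * (h b + k)] (mod gcd c (int b))"
    by (rule cong_dvd_modulus) simp
  ultimately show ?thesis
    by (simp add: cong_dvd_iff)
qed

section \<open>Turning ones into zeros\<close>

lemma coding_kill_one:
  assumes "0 \<notin> B" and "proximal B" and "finite I" and h: "h \<in> H B"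
  shows "\<exists>h'\<in>H B. \<forall>n\<in>I. coding B h' n = (if n = k then 0 else coding B h n)"
proof -
  have pos: "b > 0" if "b \<in> B" for b
    using assms that by (cases b) auto
  \<comment> \<open>For every zero in \<open>I\<close> one coordinate is protected that causes it.\<close>
  define Z where "Z = {n \<in> I. coding B h n = 0}"
  have "\<forall>n\<in>Z. \<exists>b\<in>B. int b dvd h b + n"
    by (auto simp: Z_def coding_eq[OF assms(1) h] split: if_splits)
  then obtain w where w: "\<And>n. n \<in> Z \<Longrightarrow> w n \<in> B \<and> int (w n) dvd h (w n) + n"
    by metis
  define M where "M = (\<Prod>n\<in>Z. int (w n)) * (\<Prod>n\<in>I - {k}. \<bar>n - k\<bar>)"
  have finZ: "finite Z"
    using assms(3) by (simp add: Z_def)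
  have "M > 0"
    unfolding M_def using w pos by (intro mult_pos_pos prod_pos) auto
  then obtain c where c: "c \<in> B" "coprime (int c) M"
    using proximal_imp_coprime_element[OF assms(1,2)] by blast
  have c_w: "coprime (int c) (int (w n))" if "n \<in> Z" for n
  proof -
    have "int (w n) dvd M"
      using that finZ by (auto simp: M_def intro: dvd_mult2 dvd_prodI)
    then show ?thesis
      using c(2) coprime_divisors[OF dvd_refl] by blast
  qed
  have c_diff: "coprime (int c) (n - k)" if "n \<in> I" "n \<noteq> k" for n
  proof -
    have "\<bar>n - k\<bar> dvd M"
      using that assms(3) unfolding M_def by (intro dvd_mult dvd_prodI[of "I - {k}" _ "\<lambda>n. \<bar>n - k\<bar>"]) auto
    then have "n - k dvd M"
      by simp
    then show ?thesis
      using c(2) coprime_divisors[OF dvd_refl] by blast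
  qed
  define h' where "h' = pin B (int c) k h"
  have h': "h' \<in> H B"
    unfolding h'_def by (rule pin_in_H[OF assms(1) h])
  have "coding B h' n = (if n = k then 0 else coding B h n)" if n: "n \<in> I" for n
  proof (cases "n = k")
    case True
    have "int c dvd h' c + k"
      using gcd_dvd_pin[OF c(1), of "int c" k h] by (simp add: h'_def)
    with True c(1) show ?thesis
      by (auto simp: coding_eq[OF assms(1) h'])
  next
    case neq: False
    show ?thesis
    proof (cases "n \<in> Z")
      case True
      have "h' (w n) = h (w n)"
        unfolding h'_def using w[OF True] c_w[OF True] by (intro pin_coprime assms(1) h) auto
      then have "\<exists>b\<in>B. int b dvd h' b + n"
        using w[OF True] by metis
      with True neq show ?thesis
        by (simp add: coding_eq[OF assms(1) h'] Z_def)
    next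
      case False
      have "\<not> int b dvd h' b + n" if b: "b \<in> B" for b
      proof
        assume dvd: "int b dvd h' b + n"
        \<comment> \<open>The common part of \<open>b\<close> and \<open>c\<close> divides \<open>n - k\<close>, so it is trivial and the coordinate
            \<open>b\<close> has not changed.\<close>
        let ?g = "gcd (int c) (int b)"
        have "?g dvd h' b + k"
          unfolding h'_def by (rule gcd_dvd_pin[OF b])
        moreover have "?g dvd h' b + n"
          using dvd by (meson dvd_trans gcd_dvd2)
        ultimately have "?g dvd (h' b + n) - (h' b + k)"
          by (rule dvd_diff[rotated])
        then have "?g dvd n - k"
          by simp
        then have "is_unit ?g"
          using c_diff[OF n neq] gcd_dvd1 coprime_common_divisor by blast
        then have "coprime (int c) (int b)"
          by (simp only: is_unit_gcd)
        then have "h' b = h b"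
          unfolding h'_def by (intro pin_coprime assms(1) h b)
        with dvd b n have "n \<in> Z"
          by (auto simp: Z_def coding_eq[OF assms(1) h])
        with False show False ..
      qed
      then show ?thesis
        using neq n False by (auto simp: Z_def coding_eq[OF assms(1) h'] coding_eq[OF assms(1) h]
            split: if_splits)
    qed
  qed
  with h' show ?thesis
    by blast
qed

lemma coding_kill:
  assumes "0 \<notin> B" and "proximal B" and "finite I" and "finite A" and "h \<in> H B"
  shows "\<exists>h'\<in>H B. \<forall>n\<in>I. coding B h' n = (if n \<in> A then 0 else coding B h n)"
  using assms(4)
proof (induction A rule: finite_induct)
  case empty
  then show ?case
    using assms(5) by auto
next
  case (insert k A)
  then obtain h1 where h1: "h1 \<in> H B" "\<forall>n\<in>I. coding B h1 n = (if n \<in> A then 0 else coding B h n)"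
    by blast
  obtain h2 where "h2 \<in> H B" "\<forall>n\<in>I. coding B h2 n = (if n = k then 0 else coding B h1 n)"
    using coding_kill_one[OF assms(1-3) h1(1)] by blast
  with h1(2) show ?case
    by (intro bexI[of _ h2]) auto
qed

theorem corollary1:
  fixes B :: "nat set"
  assumes "0 \<notin> B" and "B \<noteq> {}" and "primitive B" and "proximal B"
  shows "X_phi B = hereditary_closure (X_phi B) \<and> hereditary (X_phi B)"
proof -
  have "X_phi B \<subseteq> hereditary_closure (X_phi B)"
    by (auto simp: hereditary_closure_def X_phi_iff)
  moreover have "hereditary_closure (X_phi B) \<subseteq> X_phi B"
  proof
    fix x' assume "x' \<in> hereditary_closure (X_phi B)"
    then obtain x where x': "x' \<in> topspace full_shift" and x: "x \<in> X_phi B" and le: "x' \<le> x"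
      by (auto simp: hereditary_closure_def)
    have "\<exists>h'\<in>H B. \<forall>n\<in>F. coding B h' n = x' n" if F: "finite F" for F
    proof -
      obtain h where h: "h \<in> H B" "\<forall>n\<in>F. coding B h n = x n"
        using x F unfolding X_phi_iff by blast
      have "finite {n \<in> F. x' n = 0}"
        using F by simp
      then obtain h' where h': "h' \<in> H B"
        "\<forall>n\<in>F. coding B h' n = (if n \<in> {n \<in> F. x' n = 0} then 0 else coding B h n)"
        using coding_kill[OF assms(1,4) F _ h(1)] by blast
      have "x n = 1" if "x' n \<noteq> 0" for n
      proof -
        have "x n = 0 \<or> x n = 1"
          using x by (auto simp: X_phi_iff topspace_full_shift)
        moreover have "x' n \<le> x n"
          using le by (simp add: le_fun_def)
        ultimately show ?thesis
          using that by linarith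
      qed
      moreover have "x' n = 0 \<or> x' n = 1" for n
        using x' by (simp add: topspace_full_shift)
      ultimately have "(if x' n = 0 then 0 else x n) = x' n" for n
        by metis
      then have "\<forall>n\<in>F. coding B h' n = x' n"
        using h'(2) h(2) by (metis (mono_tags, lifting) mem_Collect_eq)
      with h'(1) show ?thesis
        by blast
    qed
    with x' show "x' \<in> X_phi B"
      by (simp add: X_phi_iff)
  qed
  ultimately show ?thesis
    by (auto simp: hereditary_def)
qed

end
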